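(* Let $\mathscr{C}$ and $\mathscr{D}$ be monoidal categories with Saavedra units $(I,\alpha)$ and $(J,\beta)$ respectively, and let $(F,\phi_2):\mathscr{C}\to\mathscr{D}$ be a strong multiplicative functor. Then $F$ is monoidal (i.e. there exists a unit compatibility $\phi_0:J\to F(I)$) if and only if the image of the unit, namely the object $F(I)$ equipped with the composite $F(I)F(I)\xrightarrow{\phi_{I,I}}F(II)\xrightarrow{F(\alpha)}F(I)$, is a Saavedra unit in $\mathscr{D}$.
   Context: A semi-monoidal category is a category with a strictly associative functor $\mathscr{C}\times\mathscr{C}\to\mathscr{C}$, written as juxtaposition. The identity arrow of an object $X$ is also written $X$. An object $I$ is cancellable if the functors $X\mapsto IX$ and $X\mapsto XI$ are both fully faithful. A Saavedra unit is a pair $(I,\alpha)$ where $I$ is cancellable and $\alpha: II\to I$ is an isomorphism. A monoidal category is a semi-monoidal category with a chosen Saavedra unit. A strong multiplicative functor $(F,\phi_2)$ is a functor $F$ with natural isomorphisms $\phi_{X,Y}:F(X)F(Y)\to F(XY)$ such that $\phi_{XY,Z}\circ(\phi_{X,Y}F(Z))=\phi_{X,YZ}\circ(F(X)\phi_{Y,Z})$. A unit compatibility is an isomorphism $\phi_0:J\to F(I)$ with $\phi_0\circ\beta=F(\alpha)\circ\phi_{I,I}\circ(\phi_0\phi_0)$. *)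

theory Defs
  imports Main
begin

section \<open>Categories, functors, natural isomorphisms\<close>

text \<open>
  A category has explicit carriers of objects and arrows; nothing is assumed about values of
  the operations outside the carriers. Composition is in applicative order.
\<close>

record ('o, 'a) category =
  obj :: "'o set"
  arr :: "'a set"
  src :: "'a \<Rightarrow> 'o"
  tgt :: "'a \<Rightarrow> 'o"
  idt :: "'o \<Rightarrow> 'a"
  cmp :: "'a \<Rightarrow> 'a \<Rightarrow> 'a"  (infixl \<open>\<cdot>\<index>\<close> 65)

definition hom :: "('o, 'a, 'm) category_scheme \<Rightarrow> 'o \<Rightarrow> 'o \<Rightarrow> 'a set" where
  "hom C X Y = {f \<in> arr C. src C f = X \<and> tgt C f = Y}"

locale category =
  fixes C :: "('o, 'a, 'm) category_scheme" (structure)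
  assumes src_obj: "f \<in> arr C \<Longrightarrow> src C f \<in> obj C"
    and tgt_obj: "f \<in> arr C \<Longrightarrow> tgt C f \<in> obj C"
    and idt_hom: "X \<in> obj C \<Longrightarrow> idt C X \<in> hom C X X"
    and cmp_hom: "f \<in> hom C X Y \<Longrightarrow> g \<in> hom C Y Z \<Longrightarrow> g \<cdot> f \<in> hom C X Z"
    and idt_left: "f \<in> hom C X Y \<Longrightarrow> idt C Y \<cdot> f = f"
    and idt_right: "f \<in> hom C X Y \<Longrightarrow> f \<cdot> idt C X = f"
    and cmp_assoc: "f \<in> hom C X Y \<Longrightarrow> g \<in> hom C Y Z \<Longrightarrow> h \<in> hom C Z W \<Longrightarrow>
      h \<cdot> g \<cdot> f = h \<cdot> (g \<cdot> f)"

definition iso_in :: "('o, 'a, 'm) category_scheme \<Rightarrow> 'o \<Rightarrow> 'o \<Rightarrow> 'a \<Rightarrow> bool" where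
  "iso_in C X Y f \<longleftrightarrow> f \<in> hom C X Y \<and>
    (\<exists>g \<in> hom C Y X. g \<cdot>\<^bsub>C\<^esub> f = idt C X \<and> f \<cdot>\<^bsub>C\<^esub> g = idt C Y)"

definition prod_cat ::
    "('o, 'a, 'm) category_scheme \<Rightarrow> ('p, 'b, 'n) category_scheme \<Rightarrow> ('o \<times> 'p, 'a \<times> 'b) category"
  where
  "prod_cat C D = \<lparr>
    obj = obj C \<times> obj D,
    arr = arr C \<times> arr D,
    src = (\<lambda>(f, g). (src C f, src D g)),
    tgt = (\<lambda>(f, g). (tgt C f, tgt D g)),
    idt = (\<lambda>(X, Y). (idt C X, idt D Y)),
    cmp = (\<lambda>(f, g) (f', g'). (f \<cdot>\<^bsub>C\<^esub> f', g \<cdot>\<^bsub>D\<^esub> g'))\<rparr>"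

record ('o, 'a, 'p, 'b) cfunctor =
  on_obj :: "'o \<Rightarrow> 'p"
  on_arr :: "'a \<Rightarrow> 'b"

locale functor_between = C: category C + D: category D
  for C :: "('o, 'a, 'm) category_scheme" and D :: "('p, 'b, 'n) category_scheme" +
  fixes F :: "('o, 'a, 'p, 'b) cfunctor"
  assumes on_obj_obj: "X \<in> obj C \<Longrightarrow> on_obj F X \<in> obj D"
    and on_arr_hom: "f \<in> hom C X Y \<Longrightarrow> on_arr F f \<in> hom D (on_obj F X) (on_obj F Y)"
    and on_arr_idt: "X \<in> obj C \<Longrightarrow> on_arr F (idt C X) = idt D (on_obj F X)"
    and on_arr_cmp: "f \<in> hom C X Y \<Longrightarrow> g \<in> hom C Y Z \<Longrightarrow>
      on_arr F (g \<cdot>\<^bsub>C\<^esub> f) = on_arr F g \<cdot>\<^bsub>D\<^esub> on_arr F f"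

definition fully_faithful ::
    "('o, 'a, 'm) category_scheme \<Rightarrow> ('p, 'b, 'n) category_scheme \<Rightarrow>
      ('o, 'a, 'p, 'b) cfunctor \<Rightarrow> bool" where
  "fully_faithful C D F \<longleftrightarrow> functor_between C D F \<and>
    (\<forall>X \<in> obj C. \<forall>Y \<in> obj C.
      bij_betw (on_arr F) (hom C X Y) (hom D (on_obj F X) (on_obj F Y)))"

definition comp_functor ::
    "('p, 'b, 'q, 'c) cfunctor \<Rightarrow> ('o, 'a, 'p, 'b) cfunctor \<Rightarrow> ('o, 'a, 'q, 'c) cfunctor" where
  "comp_functor G F = \<lparr>on_obj = on_obj G \<circ> on_obj F, on_arr = on_arr G \<circ> on_arr F\<rparr>"

definition prod_functor ::
    "('o, 'a, 'p, 'b) cfunctor \<Rightarrow> ('o', 'a', 'p', 'b') cfunctor \<Rightarrow>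
      ('o \<times> 'o', 'a \<times> 'a', 'p \<times> 'p', 'b \<times> 'b') cfunctor" where
  "prod_functor F G =
    \<lparr>on_obj = map_prod (on_obj F) (on_obj G), on_arr = map_prod (on_arr F) (on_arr G)\<rparr>"

locale natural_isomorphism = F: functor_between C D F + G: functor_between C D G
  for C :: "('o, 'a, 'm) category_scheme" and D :: "('p, 'b, 'n) category_scheme"
    and F G :: "('o, 'a, 'p, 'b) cfunctor" +
  fixes \<tau> :: "'o \<Rightarrow> 'b"
  assumes component_iso: "X \<in> obj C \<Longrightarrow> iso_in D (on_obj F X) (on_obj G X) (\<tau> X)"
    and naturality: "f \<in> hom C X Y \<Longrightarrow> on_arr G f \<cdot>\<^bsub>D\<^esub> \<tau> X = \<tau> Y \<cdot>\<^bsub>D\<^esub> on_arr F f"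

section \<open>Semi-monoidal categories and Saavedra units\<close>

record ('o, 'a) semi_monoidal = "('o, 'a) category" +
  tensor :: "('o \<times> 'o, 'a \<times> 'a, 'o, 'a) cfunctor"

abbreviation tensor_obj ::
    "('o, 'a, 'm) semi_monoidal_scheme \<Rightarrow> 'o \<Rightarrow> 'o \<Rightarrow> 'o"  (infixl \<open>\<odot>\<index>\<close> 70) where
  "tensor_obj C X Y \<equiv> on_obj (tensor C) (X, Y)"

abbreviation tensor_arr ::
    "('o, 'a, 'm) semi_monoidal_scheme \<Rightarrow> 'a \<Rightarrow> 'a \<Rightarrow> 'a"  (infixl \<open>\<otimes>\<index>\<close> 70) where
  "tensor_arr C f g \<equiv> on_arr (tensor C) (f, g)"

locale semi_monoidal_category =
  category C + tensor: functor_between "prod_cat C C" C "tensor C"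
  for C :: "('o, 'a, 'm) semi_monoidal_scheme" (structure) +
  assumes tensor_obj_assoc:
      "X \<in> obj C \<Longrightarrow> Y \<in> obj C \<Longrightarrow> Z \<in> obj C \<Longrightarrow> X \<odot> Y \<odot> Z = X \<odot> (Y \<odot> Z)"
    and tensor_arr_assoc:
      "f \<in> arr C \<Longrightarrow> g \<in> arr C \<Longrightarrow> h \<in> arr C \<Longrightarrow> f \<otimes> g \<otimes> h = f \<otimes> (g \<otimes> h)"

definition tensor_left ::
    "('o, 'a, 'm) semi_monoidal_scheme \<Rightarrow> 'o \<Rightarrow> ('o, 'a, 'o, 'a) cfunctor" where
  "tensor_left C I = \<lparr>on_obj = (\<lambda>X. I \<odot>\<^bsub>C\<^esub> X), on_arr = (\<lambda>f. idt C I \<otimes>\<^bsub>C\<^esub> f)\<rparr>"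

definition tensor_right ::
    "('o, 'a, 'm) semi_monoidal_scheme \<Rightarrow> 'o \<Rightarrow> ('o, 'a, 'o, 'a) cfunctor" where
  "tensor_right C I = \<lparr>on_obj = (\<lambda>X. X \<odot>\<^bsub>C\<^esub> I), on_arr = (\<lambda>f. f \<otimes>\<^bsub>C\<^esub> idt C I)\<rparr>"

definition cancellable :: "('o, 'a, 'm) semi_monoidal_scheme \<Rightarrow> 'o \<Rightarrow> bool" where
  "cancellable C I \<longleftrightarrow> I \<in> obj C \<and>
    fully_faithful C C (tensor_left C I) \<and> fully_faithful C C (tensor_right C I)"

definition saavedra_unit :: "('o, 'a, 'm) semi_monoidal_scheme \<Rightarrow> 'o \<Rightarrow> 'a \<Rightarrow> bool" where
  "saavedra_unit C I \<alpha> \<longleftrightarrow> cancellable C I \<and> iso_in C (I \<odot>\<^bsub>C\<^esub> I) I \<alpha>"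

locale monoidal_category = semi_monoidal_category C
  for C :: "('o, 'a, 'm) semi_monoidal_scheme" (structure) +
  fixes I :: 'o and \<alpha> :: 'a
  assumes unit: "saavedra_unit C I \<alpha>"

section \<open>Strong multiplicative functors and unit compatibilities\<close>

locale strong_multiplicative_functor =
  C: semi_monoidal_category C + D: semi_monoidal_category D + functor_between C D F +
  natural_isomorphism "prod_cat C C" D
    "comp_functor (tensor D) (prod_functor F F)" "comp_functor F (tensor C)"
    "\<lambda>(X, Y). \<phi> X Y"
  for C :: "('o, 'a, 'm) semi_monoidal_scheme" and D :: "('p, 'b, 'n) semi_monoidal_scheme"
    and F :: "('o, 'a, 'p, 'b) cfunctor" and \<phi> :: "'o \<Rightarrow> 'o \<Rightarrow> 'b" +
  assumes multiplicativity: "X \<in> obj C \<Longrightarrow> Y \<in> obj C \<Longrightarrow> Z \<in> obj C \<Longrightarrow>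
    \<phi> (X \<odot>\<^bsub>C\<^esub> Y) Z \<cdot>\<^bsub>D\<^esub> (\<phi> X Y \<otimes>\<^bsub>D\<^esub> idt D (on_obj F Z)) =
    \<phi> X (Y \<odot>\<^bsub>C\<^esub> Z) \<cdot>\<^bsub>D\<^esub> (idt D (on_obj F X) \<otimes>\<^bsub>D\<^esub> \<phi> Y Z)"

definition unit_compatibility ::
    "'o \<Rightarrow> 'a \<Rightarrow> ('p, 'b, 'n) semi_monoidal_scheme \<Rightarrow> 'p \<Rightarrow> 'b \<Rightarrow>
      ('o, 'a, 'p, 'b) cfunctor \<Rightarrow> ('o \<Rightarrow> 'o \<Rightarrow> 'b) \<Rightarrow> 'b \<Rightarrow> bool" where
  "unit_compatibility I \<alpha> D J \<beta> F \<phi> \<phi>\<^sub>0 \<longleftrightarrow> iso_in D J (on_obj F I) \<phi>\<^sub>0 \<and>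
    \<phi>\<^sub>0 \<cdot>\<^bsub>D\<^esub> \<beta> = on_arr F \<alpha> \<cdot>\<^bsub>D\<^esub> \<phi> I I \<cdot>\<^bsub>D\<^esub> (\<phi>\<^sub>0 \<otimes>\<^bsub>D\<^esub> \<phi>\<^sub>0)"

definition monoidal_functor ::
    "'o \<Rightarrow> 'a \<Rightarrow> ('p, 'b, 'n) semi_monoidal_scheme \<Rightarrow> 'p \<Rightarrow> 'b \<Rightarrow>
      ('o, 'a, 'p, 'b) cfunctor \<Rightarrow> ('o \<Rightarrow> 'o \<Rightarrow> 'b) \<Rightarrow> bool" where
  "monoidal_functor I \<alpha> D J \<beta> F \<phi> \<longleftrightarrow> (\<exists>\<phi>\<^sub>0. unit_compatibility I \<alpha> D J \<beta> F \<phi> \<phi>\<^sub>0)"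

end

theory Submission
  imports Defs
begin

text \<open>
  If \<open>J \<cong> F I\<close>, then tensoring with \<open>F I\<close> is naturally isomorphic to tensoring with \<open>J\<close>, so
  \<open>F I\<close> is cancellable.

  Conversely, any two Saavedra units \<open>(J, \<beta>)\<close> and \<open>(K, \<gamma>)\<close> are compatibly isomorphic. By
  cancellability there are isomorphisms \<open>u : JK \<rightarrow> K\<close> with \<open>Ju = \<beta>K\<close> and \<open>r : JK \<rightarrow> J\<close> with
  \<open>rK = J\<gamma>\<close>; put \<open>\<psi> = u r\<inverse>\<close>. Since \<open>J\<beta> = \<beta>J\<close> and \<open>K\<gamma> = \<gamma>K\<close>, cancelling \<open>J\<close> and \<open>K\<close>
  gives \<open>u (J\<psi>) = \<psi> \<beta>\<close> and \<open>\<gamma> (\<psi>K) = \<psi> r = u\<close>, whence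
  \<open>\<gamma> (\<psi>\<psi>) = \<gamma> (\<psi>K) (J\<psi>) = \<psi> \<beta>\<close>.
\<close>

section \<open>Isomorphisms\<close>

context category
begin

lemma hom_arr: "f \<in> hom C X Y \<Longrightarrow> f \<in> arr C"
  by (simp add: hom_def)

lemma hom_obj:
  assumes "f \<in> hom C X Y"
  shows "X \<in> obj C" and "Y \<in> obj C"
  using assms src_obj tgt_obj by (auto simp: hom_def)

lemma iso_in_hom: "iso_in C X Y f \<Longrightarrow> f \<in> hom C X Y"
  by (simp add: iso_in_def)

lemma iso_inE:
  assumes "iso_in C X Y f"
  obtains g where "iso_in C Y X g" "g \<cdot> f = idt C X" "f \<cdot> g = idt C Y"
  using assms by (auto simp: iso_in_def)

lemma iso_in_idt: "X \<in> obj C \<Longrightarrow> iso_in C X X (idt C X)"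
  using idt_hom idt_left unfolding iso_in_def by blast

lemma cmp_cancel_left:
  assumes "h \<in> hom C Y Z" "f \<in> hom C X Y" "k \<in> hom C Z Y" "k \<cdot> h = idt C Y"
  shows "k \<cdot> (h \<cdot> f) = f"
  using cmp_assoc[OF assms(2,1,3)] idt_left[OF assms(2)] assms(4) by simp

lemma cmp_cancel_right:
  assumes "h \<in> hom C X Y" "g \<in> hom C Y Z" "k \<in> hom C Y X" "h \<cdot> k = idt C Y"
  shows "g \<cdot> h \<cdot> k = g"
  using cmp_assoc[OF assms(3,1,2)] idt_right[OF assms(2)] assms(4) by simp

text \<open>An isomorphism has a right inverse, and composing with it strips \<open>h\<close> from
  both sides.\<close>

lemma iso_in_epic:
  assumes "iso_in C X Y h" "f \<in> hom C Y Z" "g \<in> hom C Y Z" "f \<cdot> h = g \<cdot> h"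
  shows "f = g"
proof -
  obtain k where k: "k \<in> hom C Y X" "h \<cdot> k = idt C Y"
    using assms(1) by (auto simp: iso_in_def)
  show ?thesis
    using cmp_cancel_right[OF iso_in_hom[OF assms(1)] _ k] assms(2-4) by metis
qed

lemma iso_in_cmp:
  assumes f: "iso_in C X Y f" and g: "iso_in C Y Z g"
  shows "iso_in C X Z (g \<cdot> f)"
proof -
  obtain f' where f': "f' \<in> hom C Y X" "f' \<cdot> f = idt C X" "f \<cdot> f' = idt C Y"
    using f by (auto simp: iso_in_def)
  obtain g' where g': "g' \<in> hom C Z Y" "g' \<cdot> g = idt C Y" "g \<cdot> g' = idt C Z"
    using g by (auto simp: iso_in_def)
  have fh: "f \<in> hom C X Y" and gh: "g \<in> hom C Y Z"
    using f g by (auto intro: iso_in_hom)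
  have "f' \<cdot> g' \<cdot> (g \<cdot> f) = f' \<cdot> (g' \<cdot> (g \<cdot> f))"
    using cmp_assoc cmp_hom fh gh f'(1) g'(1) by blast
  then have 1: "f' \<cdot> g' \<cdot> (g \<cdot> f) = idt C X"
    using cmp_cancel_left[OF gh fh g'(1,2)] f' by simp
  have "g \<cdot> f \<cdot> (f' \<cdot> g') = g \<cdot> f \<cdot> f' \<cdot> g'"
    using cmp_assoc cmp_hom fh gh f'(1) g'(1) by metis
  then have 2: "g \<cdot> f \<cdot> (f' \<cdot> g') = idt C Z"
    using cmp_cancel_right[OF fh gh f'(1,3)] g' by simp
  show ?thesis
    unfolding iso_in_def using 1 2 cmp_hom fh gh f'(1) g'(1) by blast
qed

text \<open>Conjugating back by \<open>\<sigma>\<close> and the inverse of \<open>\<tau>\<close>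
  undoes the map. The inverse \<open>k\<close> of \<open>\<sigma>\<close> is a parameter so that the
  bijection is a concrete function, which can be compared pointwise with the action of a
  functor.\<close>

lemma conjugation_bij_betw:
  assumes \<sigma>: "iso_in C X X' \<sigma>" and \<tau>: "iso_in C Y Y' \<tau>"
    and k: "k \<in> hom C X' X" "k \<cdot> \<sigma> = idt C X" "\<sigma> \<cdot> k = idt C X'"
  shows "bij_betw (\<lambda>f. \<tau> \<cdot> f \<cdot> k) (hom C X Y) (hom C X' Y')"
proof -
  obtain \<tau>' where \<tau>': "\<tau>' \<in> hom C Y' Y" "\<tau>' \<cdot> \<tau> = idt C Y" "\<tau> \<cdot> \<tau>' = idt C Y'"
    using \<tau> by (auto simp: iso_in_def)
  have h: "\<sigma> \<in> hom C X X'" "\<tau> \<in> hom C Y Y'"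
    using \<sigma> \<tau> by (auto intro: iso_in_hom)
  show ?thesis
  proof (rule bij_betw_byWitness[where f' = "\<lambda>g. \<tau>' \<cdot> g \<cdot> \<sigma>"])
    show "\<forall>f\<in>hom C X Y. \<tau>' \<cdot> (\<tau> \<cdot> f \<cdot> k) \<cdot> \<sigma> = f"
    proof
      fix f assume f: "f \<in> hom C X Y"
      have "\<tau>' \<cdot> (\<tau> \<cdot> f \<cdot> k) = \<tau>' \<cdot> (\<tau> \<cdot> (f \<cdot> k))"
        using cmp_assoc[OF k(1) f h(2)] by simp
      also have "\<dots> = f \<cdot> k"
        using cmp_cancel_left[OF h(2) cmp_hom[OF k(1) f] \<tau>'(1,2)] .
      finally show "\<tau>' \<cdot> (\<tau> \<cdot> f \<cdot> k) \<cdot> \<sigma> = f"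
        using cmp_cancel_right[OF k(1) f h(1) k(2)] by simp
    qed
    show "\<forall>g\<in>hom C X' Y'. \<tau> \<cdot> (\<tau>' \<cdot> g \<cdot> \<sigma>) \<cdot> k = g"
    proof
      fix g assume g: "g \<in> hom C X' Y'"
      have "\<tau> \<cdot> (\<tau>' \<cdot> g \<cdot> \<sigma>) = \<tau> \<cdot> (\<tau>' \<cdot> (g \<cdot> \<sigma>))"
        using cmp_assoc[OF h(1) g \<tau>'(1)] by simp
      also have "\<dots> = g \<cdot> \<sigma>"
        using cmp_cancel_left[OF \<tau>'(1) cmp_hom[OF h(1) g] h(2) \<tau>'(3)] .
      finally show "\<tau> \<cdot> (\<tau>' \<cdot> g \<cdot> \<sigma>) \<cdot> k = g"
        using cmp_cancel_right[OF h(1) g k(1) k(3)] by simp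
    qed
  qed (use h k(1) \<tau>'(1) cmp_hom in blast)+
qed

end

lemma (in functor_between) iso_in_on_arr:
  assumes "iso_in C X Y f"
  shows "iso_in D (on_obj F X) (on_obj F Y) (on_arr F f)"
proof -
  obtain g where "f \<in> hom C X Y" "g \<in> hom C Y X" "g \<cdot>\<^bsub>C\<^esub> f = idt C X" "f \<cdot>\<^bsub>C\<^esub> g = idt C Y"
    using assms by (auto simp: iso_in_def)
  then show ?thesis
    unfolding iso_in_def by (metis C.hom_obj on_arr_cmp on_arr_hom on_arr_idt)
qed

section \<open>Fully faithful functors\<close>

text \<open>Naturality forces \<open>G\<close> on an arrow to be its image under \<open>F\<close>
  conjugated by the components of \<open>\<tau>\<close>. On each hom-set \<open>G\<close> is
  therefore a composite of two bijections.\<close>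

lemma (in natural_isomorphism) fully_faithful_transport:
  assumes "fully_faithful C D F"
  shows "fully_faithful C D G"
  unfolding fully_faithful_def
proof (intro conjI ballI)
  show "functor_between C D G" by (rule G.functor_between_axioms)
next
  fix X Y assume X: "X \<in> obj C" and Y: "Y \<in> obj C"
  obtain k where k: "k \<in> hom D (on_obj G X) (on_obj F X)"
      "k \<cdot>\<^bsub>D\<^esub> \<tau> X = idt D (on_obj F X)" "\<tau> X \<cdot>\<^bsub>D\<^esub> k = idt D (on_obj G X)"
    using component_iso[OF X] by (auto simp: iso_in_def)
  have "bij_betw (on_arr F) (hom C X Y) (hom D (on_obj F X) (on_obj F Y))"
    using assms X Y by (auto simp: fully_faithful_def)
  then have "bij_betw ((\<lambda>f. \<tau> Y \<cdot>\<^bsub>D\<^esub> f \<cdot>\<^bsub>D\<^esub> k) \<circ> on_arr F) (hom C X Y)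
      (hom D (on_obj G X) (on_obj G Y))"
    by (rule bij_betw_trans)
      (rule F.D.conjugation_bij_betw[OF component_iso[OF X] component_iso[OF Y] k])
  moreover have "((\<lambda>f. \<tau> Y \<cdot>\<^bsub>D\<^esub> f \<cdot>\<^bsub>D\<^esub> k) \<circ> on_arr F) f = on_arr G f"
    if f: "f \<in> hom C X Y" for f
    using naturality[OF f] k
      F.D.cmp_cancel_right[OF F.D.iso_in_hom[OF component_iso[OF X]] G.on_arr_hom[OF f] k(1,3)]
    by simp
  ultimately show "bij_betw (on_arr G) (hom C X Y) (hom D (on_obj G X) (on_obj G Y))"
    using bij_betw_cong by blast
qed

lemma fully_faithful_full:
  assumes "fully_faithful C D F" "X \<in> obj C" "Y \<in> obj C" "g \<in> hom D (on_obj F X) (on_obj F Y)"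
  obtains f where "f \<in> hom C X Y" "on_arr F f = g"
proof -
  have "g \<in> on_arr F ` hom C X Y"
    using assms by (auto simp: fully_faithful_def bij_betw_def)
  then show thesis using that by blast
qed

lemma fully_faithful_faithful:
  assumes "fully_faithful C D F" "f \<in> hom C X Y" "g \<in> hom C X Y" "on_arr F f = on_arr F g"
  shows "f = g"
proof -
  interpret functor_between C D F using assms(1) by (simp add: fully_faithful_def)
  show ?thesis
    using assms C.hom_obj[OF assms(2)] unfolding fully_faithful_def bij_betw_def
    by (meson inj_onD)
qed

text \<open>Fullness lifts both \<open>g\<close> and its inverse. The composites of the lifts are
  sent to identities, so by faithfulness they are identities.\<close>

lemma fully_faithful_iso_lift:
  assumes ff: "fully_faithful C D F" and X: "X \<in> obj C" and Y: "Y \<in> obj C"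
    and g: "iso_in D (on_obj F X) (on_obj F Y) g"
  obtains f where "iso_in C X Y f" "on_arr F f = g"
proof -
  interpret functor_between C D F using ff by (simp add: fully_faithful_def)
  obtain g' where g': "g' \<in> hom D (on_obj F Y) (on_obj F X)"
      "g' \<cdot>\<^bsub>D\<^esub> g = idt D (on_obj F X)" "g \<cdot>\<^bsub>D\<^esub> g' = idt D (on_obj F Y)"
    and gh: "g \<in> hom D (on_obj F X) (on_obj F Y)"
    using g by (auto simp: iso_in_def)
  obtain f where f: "f \<in> hom C X Y" "on_arr F f = g"
    using fully_faithful_full[OF ff X Y gh] .
  obtain f' where f': "f' \<in> hom C Y X" "on_arr F f' = g'"
    using fully_faithful_full[OF ff Y X g'(1)] .
  have "f' \<cdot>\<^bsub>C\<^esub> f = idt C X"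
    using f f' g' X by (intro fully_faithful_faithful[OF ff])
      (auto intro: C.cmp_hom C.idt_hom simp: on_arr_cmp on_arr_idt)
  moreover have "f \<cdot>\<^bsub>C\<^esub> f' = idt C Y"
    using f f' g' Y by (intro fully_faithful_faithful[OF ff])
      (auto intro: C.cmp_hom C.idt_hom simp: on_arr_cmp on_arr_idt)
  ultimately show thesis
    using that f f' unfolding iso_in_def by blast
qed

section \<open>Cancellable objects and Saavedra units\<close>

lemma prod_cat_hom:
  "(f, g) \<in> hom (prod_cat C D) (X, Y) (X', Y') \<longleftrightarrow> f \<in> hom C X X' \<and> g \<in> hom D Y Y'"
  by (auto simp: hom_def prod_cat_def)

context semi_monoidal_category
begin

lemma tensor_obj_obj: "X \<in> obj C \<Longrightarrow> Y \<in> obj C \<Longrightarrow> X \<odot> Y \<in> obj C"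
  by (rule tensor.on_obj_obj) (simp add: prod_cat_def)

lemma tensor_hom:
  "f \<in> hom C X X' \<Longrightarrow> g \<in> hom C Y Y' \<Longrightarrow> f \<otimes> g \<in> hom C (X \<odot> Y) (X' \<odot> Y')"
  by (rule tensor.on_arr_hom) (simp add: prod_cat_hom)

lemma tensor_idt: "X \<in> obj C \<Longrightarrow> Y \<in> obj C \<Longrightarrow> idt C X \<otimes> idt C Y = idt C (X \<odot> Y)"
  using tensor.on_arr_idt[of "(X, Y)"] by (simp add: prod_cat_def)

lemma interchange:
  assumes "f \<in> hom C X Y" "g \<in> hom C Y Z" "f' \<in> hom C X' Y'" "g' \<in> hom C Y' Z'"
  shows "(g \<otimes> g') \<cdot> (f \<otimes> f') = (g \<cdot> f) \<otimes> (g' \<cdot> f')"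
  using tensor.on_arr_cmp[of "(f, f')" "(X, X')" "(Y, Y')" "(g, g')" "(Z, Z')"] assms
  \<comment> \<open>The hom conditions are split while \<open>prod_cat\<close> is still folded; only
    then is it unfolded to compute composites of pairs.\<close>
  by (simp add: prod_cat_hom) (simp add: prod_cat_def)

text \<open>A pair of isomorphisms is an isomorphism of the product category, inverted
  componentwise, and the functor \<open>tensor\<close> preserves isomorphisms.\<close>

lemma tensor_iso_in:
  assumes "iso_in C X X' f" "iso_in C Y Y' g"
  shows "iso_in C (X \<odot> Y) (X' \<odot> Y') (f \<otimes> g)"
proof (rule tensor.iso_in_on_arr)
  obtain f' g' where "f' \<in> hom C X' X" "f' \<cdot> f = idt C X" "f \<cdot> f' = idt C X'"
      "g' \<in> hom C Y' Y" "g' \<cdot> g = idt C Y" "g \<cdot> g' = idt C Y'"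
    using assms by (auto simp: iso_in_def)
  then show "iso_in (prod_cat C C) (X, Y) (X', Y') (f, g)"
    using assms unfolding iso_in_def
    by (intro conjI bexI[of _ "(f', g')"]) (auto simp: prod_cat_hom, auto simp: prod_cat_def)
qed

text \<open>Either factor may act first. Equating the two forms lets arrows in different factors
  slide past each other, which is the source of the naturality squares and exchange steps
  below.\<close>

lemma tensor_factor:
  assumes "f \<in> hom C X X'" "g \<in> hom C Y Y'"
  shows "(f \<otimes> idt C Y') \<cdot> (idt C X \<otimes> g) = f \<otimes> g"
    and "(idt C X' \<otimes> g) \<cdot> (f \<otimes> idt C Y) = f \<otimes> g"
  using interchange[OF idt_hom[OF hom_obj(1)[OF assms(1)]] assms(1) assms(2)
      idt_hom[OF hom_obj(2)[OF assms(2)]]]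
    interchange[OF assms(1) idt_hom[OF hom_obj(2)[OF assms(1)]]
      idt_hom[OF hom_obj(1)[OF assms(2)]] assms(2)]
    assms[THEN idt_left] assms[THEN idt_right]
  by simp_all

lemma whisker_cmp:
  assumes "f \<in> hom C X Y" "g \<in> hom C Y Z" "W \<in> obj C"
  shows "idt C W \<otimes> (g \<cdot> f) = (idt C W \<otimes> g) \<cdot> (idt C W \<otimes> f)"
    and "(g \<cdot> f) \<otimes> idt C W = (g \<otimes> idt C W) \<cdot> (f \<otimes> idt C W)"
  using idt_hom[OF assms(3)] interchange assms(1,2) idt_left[OF idt_hom[OF assms(3)]] by simp_all

lemma functor_between_tensor_left:
  "K \<in> obj C \<Longrightarrow> functor_between C C (tensor_left C K)"
  by unfold_locales
    (auto simp: tensor_left_def tensor_obj_obj tensor_idt whisker_cmp intro: tensor_hom idt_hom)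

lemma functor_between_tensor_right:
  "K \<in> obj C \<Longrightarrow> functor_between C C (tensor_right C K)"
  by unfold_locales
    (auto simp: tensor_right_def tensor_obj_obj tensor_idt whisker_cmp intro: tensor_hom idt_hom)

lemma cancellable_iso:
  assumes J: "cancellable C J" and \<psi>: "iso_in C J K \<psi>"
  shows "cancellable C K"
proof -
  note h = iso_in_hom[OF \<psi>] and K = hom_obj(2)[OF iso_in_hom[OF \<psi>]]
  have J': "J \<in> obj C" using J by (simp add: cancellable_def)
  \<comment> \<open>Both ways round the naturality square at \<open>f\<close> equal
    \<open>\<psi> \<otimes> f\<close>.\<close>
  have "natural_isomorphism C C (tensor_left C J) (tensor_left C K) (\<lambda>X. \<psi> \<otimes> idt C X)"
    using functor_between_tensor_left[OF J'] functor_between_tensor_left[OF K]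
    by (intro natural_isomorphism.intro natural_isomorphism_axioms.intro)
      (auto simp: tensor_left_def tensor_factor[OF h] intro: tensor_iso_in \<psi> iso_in_idt)
  moreover have "natural_isomorphism C C (tensor_right C J) (tensor_right C K) (\<lambda>X. idt C X \<otimes> \<psi>)"
    using functor_between_tensor_right[OF J'] functor_between_tensor_right[OF K]
    by (intro natural_isomorphism.intro natural_isomorphism_axioms.intro)
      (auto simp: tensor_right_def tensor_factor[OF _ h] intro: tensor_iso_in \<psi> iso_in_idt)
  ultimately show ?thesis
    using J K natural_isomorphism.fully_faithful_transport unfolding cancellable_def by blast
qed

text \<open>This and its right-hand version produce the unit constraints below, which are prescribed
  only after tensoring with a cancellable object.\<close>

lemma cancellable_left_lift:
  assumes "cancellable C J" "X \<in> obj C" "Y \<in> obj C" "iso_in C (J \<odot> X) (J \<odot> Y) g"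
  obtains f where "iso_in C X Y f" "idt C J \<otimes> f = g"
  using assms fully_faithful_iso_lift[of C C "tensor_left C J" X Y g]
  by (auto simp: cancellable_def tensor_left_def)

lemma cancellable_right_lift:
  assumes "cancellable C J" "X \<in> obj C" "Y \<in> obj C" "iso_in C (X \<odot> J) (Y \<odot> J) g"
  obtains f where "iso_in C X Y f" "f \<otimes> idt C J = g"
  using assms fully_faithful_iso_lift[of C C "tensor_right C J" X Y g]
  by (auto simp: cancellable_def tensor_right_def)

lemma cancellable_left_faithful:
  assumes "cancellable C J" "f \<in> hom C X Y" "g \<in> hom C X Y" "idt C J \<otimes> f = idt C J \<otimes> g"
  shows "f = g"
  using assms fully_faithful_faithful[of C C "tensor_left C J" f X Y g]
  by (auto simp: cancellable_def tensor_left_def)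

lemma cancellable_right_faithful:
  assumes "cancellable C J" "f \<in> hom C X Y" "g \<in> hom C X Y" "f \<otimes> idt C J = g \<otimes> idt C J"
  shows "f = g"
  using assms fully_faithful_faithful[of C C "tensor_right C J" f X Y g]
  by (auto simp: cancellable_def tensor_right_def)

text \<open>
  For \<open>l, r : II \<rightarrow> I\<close> with \<open>Il = \<alpha>I\<close> and \<open>rI = I\<alpha>\<close>, both \<open>IIl\<close> and \<open>rII\<close> equal the
  isomorphism \<open>I\<alpha>I\<close>; cancelling it in the interchange law \<open>(rI)(IIl) = (Il)(rII)\<close> leaves
  \<open>rI = Il\<close>.
\<close>

lemma saavedra_unit_assoc:
  assumes "saavedra_unit C I \<alpha>"
  shows "idt C I \<otimes> \<alpha> = \<alpha> \<otimes> idt C I"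
proof -
  have canc: "cancellable C I" and \<alpha>: "iso_in C (I \<odot> I) I \<alpha>" and I: "I \<in> obj C"
    using assms by (auto simp: saavedra_unit_def cancellable_def)
  have II: "I \<odot> I \<in> obj C" using tensor_obj_obj[OF I I] .
  note iI = iso_in_idt[OF I] and a = hom_arr[OF iso_in_hom]
  \<comment> \<open>Associativity is an equality of objects, so
    \<open>\<alpha> \<otimes> idt C I\<close> can be given the source I(II) required for left
    lifting, and \<open>idt C I \<otimes> \<alpha>\<close> the source (II)I required for right
    lifting.\<close>
  have assoc: "I \<odot> I \<odot> I = I \<odot> (I \<odot> I)" using I by (simp add: tensor_obj_assoc)
  obtain l where l: "iso_in C (I \<odot> I) I l" "idt C I \<otimes> l = \<alpha> \<otimes> idt C I"
    using cancellable_left_lift[OF canc II I tensor_iso_in[OF \<alpha> iI, unfolded assoc]] .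
  obtain r where r: "iso_in C (I \<odot> I) I r" "r \<otimes> idt C I = idt C I \<otimes> \<alpha>"
    using cancellable_right_lift[OF canc II I tensor_iso_in[OF iI \<alpha>, folded assoc]] .
  have lh: "l \<in> hom C (I \<odot> I) I" and rh: "r \<in> hom C (I \<odot> I) I"
    using l r iso_in_hom by auto
  have "idt C (I \<odot> I) \<otimes> l = idt C I \<otimes> \<alpha> \<otimes> idt C I"
    using a[OF l(1)] a[OF \<alpha>] a[OF iI] l(2) I by (simp flip: tensor_idt add: tensor_arr_assoc)
  also have "\<dots> = r \<otimes> idt C (I \<odot> I)"
    using a[OF r(1)] a[OF \<alpha>] a[OF iI] r(2) I by (simp flip: tensor_idt tensor_arr_assoc)
  finally have eq: "idt C (I \<odot> I) \<otimes> l = r \<otimes> idt C (I \<odot> I)" .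
  \<comment> \<open>Both sides are \<open>r \<otimes> l\<close>; rewriting with \<open>eq\<close>
    then leaves the same isomorphism on the right of both.\<close>
  have "(r \<otimes> idt C I) \<cdot> (idt C (I \<odot> I) \<otimes> l) = (idt C I \<otimes> l) \<cdot> (r \<otimes> idt C (I \<odot> I))"
    by (simp only: tensor_factor[OF rh lh])
  then have "(r \<otimes> idt C I) \<cdot> (idt C (I \<odot> I) \<otimes> l) = (idt C I \<otimes> l) \<cdot> (idt C (I \<odot> I) \<otimes> l)"
    by (simp only: eq)
  moreover have "iso_in C (I \<odot> I \<odot> (I \<odot> I)) (I \<odot> I \<odot> I) (idt C (I \<odot> I) \<otimes> l)"
    using tensor_iso_in[OF iso_in_idt[OF II] l(1)] .
  moreover have "r \<otimes> idt C I \<in> hom C (I \<odot> I \<odot> I) (I \<odot> I)"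
      "idt C I \<otimes> l \<in> hom C (I \<odot> I \<odot> I) (I \<odot> I)"
    using tensor_hom[OF rh idt_hom[OF I]] tensor_hom[OF idt_hom[OF I] lh] assoc by simp_all
  ultimately have "r \<otimes> idt C I = idt C I \<otimes> l"
    by (rule iso_in_epic[rotated -1])
  then show ?thesis using l r by simp
qed

lemma saavedra_units_isomorphic:
  assumes J: "saavedra_unit C J \<beta>" and K: "saavedra_unit C K \<gamma>"
  obtains \<psi> where "iso_in C J K \<psi>" "\<psi> \<cdot> \<beta> = \<gamma> \<cdot> (\<psi> \<otimes> \<psi>)"
proof -
  have cJ: "cancellable C J" and \<beta>: "iso_in C (J \<odot> J) J \<beta>" and oJ: "J \<in> obj C"
    using J by (auto simp: saavedra_unit_def cancellable_def)
  have cK: "cancellable C K" and \<gamma>: "iso_in C (K \<odot> K) K \<gamma>" and oK: "K \<in> obj C"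
    using K by (auto simp: saavedra_unit_def cancellable_def)
  note oJK = tensor_obj_obj[OF oJ oK] and iJ = idt_hom[OF oJ] and iK = idt_hom[OF oK]
    and \<beta>h = iso_in_hom[OF \<beta>] and \<gamma>h = iso_in_hom[OF \<gamma>]
  \<comment> \<open>\<open>u\<close> acts as the left unit constraint of \<open>J\<close> at
    \<open>K\<close>, and \<open>r\<close> as the right unit constraint of \<open>K\<close> at
    \<open>J\<close>. Inverting \<open>r\<close> gives a path from \<open>J\<close> through JK to
    \<open>K\<close>.\<close>
  obtain u where u: "iso_in C (J \<odot> K) K u" "idt C J \<otimes> u = \<beta> \<otimes> idt C K"
    using cancellable_left_lift[OF cJ oJK oK] tensor_iso_in[OF \<beta> iso_in_idt[OF oK]]
      tensor_obj_assoc[OF oJ oJ oK] by metis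
  obtain r where r: "iso_in C (J \<odot> K) J r" "r \<otimes> idt C K = idt C J \<otimes> \<gamma>"
    using cancellable_right_lift[OF cK oJK oJ] tensor_iso_in[OF iso_in_idt[OF oJ] \<gamma>]
      tensor_obj_assoc[OF oJ oK oK] by metis
  obtain s where s: "iso_in C J (J \<odot> K) s" "s \<cdot> r = idt C (J \<odot> K)" "r \<cdot> s = idt C J"
    using iso_inE[OF r(1)] .
  note uh = iso_in_hom[OF u(1)] and rh = iso_in_hom[OF r(1)] and sh = iso_in_hom[OF s(1)]
  define \<psi> where "\<psi> = u \<cdot> s"
  have \<psi>: "iso_in C J K \<psi>" unfolding \<psi>_def using s(1) u(1) by (rule iso_in_cmp)
  note \<psi>h = iso_in_hom[OF \<psi>]
  have arrs: "\<psi> \<in> arr C" "\<beta> \<in> arr C" "\<gamma> \<in> arr C" "idt C J \<in> arr C" "idt C K \<in> arr C"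
    using \<psi>h \<beta>h \<gamma>h iJ iK by (auto intro: hom_arr)
  have "\<psi> \<cdot> r = u" unfolding \<psi>_def by (rule cmp_cancel_right[OF sh uh rh s(2)])
  have "\<psi> \<cdot> r = \<gamma> \<cdot> (\<psi> \<otimes> idt C K)"
  \<comment> \<open>Tensoring with \<open>K\<close> on the right makes the equation defining
    \<open>r\<close> available. Then \<open>\<psi>\<close> slides past \<open>\<gamma>\<close>, and
    \<open>saavedra_unit_assoc\<close> moves \<open>\<gamma>\<close> to the left factor.\<close>
  proof (rule cancellable_right_faithful[OF cK])
    show "\<psi> \<cdot> r \<in> hom C (J \<odot> K) K" using rh \<psi>h by (rule cmp_hom)
    show "\<gamma> \<cdot> (\<psi> \<otimes> idt C K) \<in> hom C (J \<odot> K) K"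
      using tensor_hom[OF \<psi>h iK] \<gamma>h by (rule cmp_hom)
    have "(\<psi> \<cdot> r) \<otimes> idt C K = (\<psi> \<otimes> idt C K) \<cdot> (idt C J \<otimes> \<gamma>)"
      by (simp add: whisker_cmp[OF rh \<psi>h oK] r)
    also have "\<dots> = (idt C K \<otimes> \<gamma>) \<cdot> (\<psi> \<otimes> idt C (K \<odot> K))"
      by (simp only: tensor_factor[OF \<psi>h \<gamma>h])
    also have "\<dots> = (\<gamma> \<otimes> idt C K) \<cdot> (\<psi> \<otimes> idt C K \<otimes> idt C K)"
      using arrs oK by (simp add: saavedra_unit_assoc[OF K] tensor_arr_assoc flip: tensor_idt)
    also have "\<dots> = (\<gamma> \<cdot> (\<psi> \<otimes> idt C K)) \<otimes> idt C K"
      by (rule whisker_cmp(2)[OF tensor_hom[OF \<psi>h iK] \<gamma>h oK, symmetric])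
    finally show "(\<psi> \<cdot> r) \<otimes> idt C K = (\<gamma> \<cdot> (\<psi> \<otimes> idt C K)) \<otimes> idt C K" .
  qed
  then have 1: "\<gamma> \<cdot> (\<psi> \<otimes> idt C K) = u" using \<open>\<psi> \<cdot> r = u\<close> by simp
  have 2: "\<psi> \<cdot> \<beta> = u \<cdot> (idt C J \<otimes> \<psi>)"
  \<comment> \<open>The mirror argument: \<open>saavedra_unit_assoc\<close> moves
    \<open>\<beta>\<close> to the left factor, \<open>\<psi>\<close> slides past it, and the
    equation defining \<open>u\<close> replaces \<open>\<beta> \<otimes> idt C K\<close>.\<close>
  proof (rule cancellable_left_faithful[OF cJ])
    show "\<psi> \<cdot> \<beta> \<in> hom C (J \<odot> J) K" using \<beta>h \<psi>h by (rule cmp_hom)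
    show "u \<cdot> (idt C J \<otimes> \<psi>) \<in> hom C (J \<odot> J) K"
      using tensor_hom[OF iJ \<psi>h] uh by (rule cmp_hom)
    have "idt C J \<otimes> (\<psi> \<cdot> \<beta>) = (idt C J \<otimes> \<psi>) \<cdot> (\<beta> \<otimes> idt C J)"
      by (simp add: whisker_cmp[OF \<beta>h \<psi>h oJ] saavedra_unit_assoc[OF J])
    also have "\<dots> = (\<beta> \<otimes> idt C K) \<cdot> (idt C (J \<odot> J) \<otimes> \<psi>)"
      by (simp only: tensor_factor[OF \<beta>h \<psi>h])
    also have "\<dots> = (idt C J \<otimes> u) \<cdot> (idt C J \<otimes> (idt C J \<otimes> \<psi>))"
      using arrs oJ by (simp add: u tensor_arr_assoc flip: tensor_idt)
    also have "\<dots> = idt C J \<otimes> (u \<cdot> (idt C J \<otimes> \<psi>))"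
      by (rule whisker_cmp(1)[OF tensor_hom[OF iJ \<psi>h] uh oJ, symmetric])
    finally show "idt C J \<otimes> (\<psi> \<cdot> \<beta>) = idt C J \<otimes> (u \<cdot> (idt C J \<otimes> \<psi>))" .
  qed
  \<comment> \<open>The two identities meet in \<open>u\<close>, and the two whiskerings of
    \<open>\<psi>\<close> recombine to \<open>\<psi> \<otimes> \<psi>\<close>.\<close>
  have "\<psi> \<cdot> \<beta> = \<gamma> \<cdot> (\<psi> \<otimes> idt C K) \<cdot> (idt C J \<otimes> \<psi>)"
    using 1 2 by simp
  also have "\<dots> = \<gamma> \<cdot> (\<psi> \<otimes> \<psi>)"
    using cmp_assoc[OF tensor_hom[OF iJ \<psi>h] tensor_hom[OF \<psi>h iK] \<gamma>h] tensor_factor(1)[OF \<psi>h \<psi>h]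
    by simp
  finally show thesis using that \<psi> by blast
qed

end

theorem corollary3p9:
  fixes C :: "('o, 'a) semi_monoidal" and D :: "('p, 'b) semi_monoidal"
    and F :: "('o, 'a, 'p, 'b) cfunctor" and \<phi> :: "'o \<Rightarrow> 'o \<Rightarrow> 'b"
    and I :: 'o and \<alpha> :: 'a and J :: 'p and \<beta> :: 'b
  assumes "monoidal_category C I \<alpha>" and "monoidal_category D J \<beta>"
    and "strong_multiplicative_functor C D F \<phi>"
  shows "monoidal_functor I \<alpha> D J \<beta> F \<phi> \<longleftrightarrow>
    saavedra_unit D (on_obj F I) (on_arr F \<alpha> \<cdot>\<^bsub>D\<^esub> \<phi> I I)"
proof -
  interpret C: monoidal_category C I \<alpha> by (fact assms(1))
  interpret D: monoidal_category D J \<beta> by (fact assms(2))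
  interpret strong_multiplicative_functor C D F \<phi> by (fact assms(3))
  have I: "I \<in> obj C" and \<alpha>: "iso_in C (I \<odot>\<^bsub>C\<^esub> I) I \<alpha>"
    using C.unit by (auto simp: saavedra_unit_def cancellable_def)
  have "iso_in D (on_obj F I \<odot>\<^bsub>D\<^esub> on_obj F I) (on_obj F (I \<odot>\<^bsub>C\<^esub> I)) (\<phi> I I)"
    using component_iso[of "(I, I)"] I
    by (simp add: prod_cat_def comp_functor_def prod_functor_def)
  \<comment> \<open>Since the structure arrow is an isomorphism, the Saavedra condition on the image
    of \<open>I\<close> reduces to cancellability.\<close>
  then have iso: "iso_in D (on_obj F I \<odot>\<^bsub>D\<^esub> on_obj F I) (on_obj F I) (on_arr F \<alpha> \<cdot>\<^bsub>D\<^esub> \<phi> I I)"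
    using iso_in_on_arr[OF \<alpha>] by (rule D.iso_in_cmp)
  show ?thesis
  proof
    assume "monoidal_functor I \<alpha> D J \<beta> F \<phi>"
    then show "saavedra_unit D (on_obj F I) (on_arr F \<alpha> \<cdot>\<^bsub>D\<^esub> \<phi> I I)"
      using D.cancellable_iso D.unit iso
      by (auto simp: monoidal_functor_def unit_compatibility_def saavedra_unit_def)
  next
    assume "saavedra_unit D (on_obj F I) (on_arr F \<alpha> \<cdot>\<^bsub>D\<^esub> \<phi> I I)"
    \<comment> \<open>With the composite structure arrow as \<open>\<gamma>\<close>, the equation
      for the comparison \<open>\<psi>\<close> is exactly the one required of a unit
      compatibility.\<close>
    then show "monoidal_functor I \<alpha> D J \<beta> F \<phi>"
      unfolding monoidal_functor_def unit_compatibility_def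
      using D.saavedra_units_isomorphic[OF D.unit] by metis
  qed
qed

end
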